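(* Let $n\in\mathbb{N}$. There is a one-to-one correspondence between the set $SC_6(n)$ of self-conjugate $6$-core partitions of $n$ and the set \[ \mathscr{S}_6 = \{ (x,y,z) \in \mathbb{Z}^3 \colon x^2+y^2+z^2 = 24n+35,\ (x,y,z) \equiv (\pm 1, \pm 3, \pm 5) \pmod{12} \}, \] where triples differing only by sign changes of their coordinates are identified.
   Context: A partition is a $6$-core if no hook length $h(j,k)=\lambda_j+\lambda'_k-j-k+1$ of a cell of its Ferrers–Young diagram is divisible by $6$, and self-conjugate if it equals its conjugate (rows and columns interchanged). *)

theory Defs
  imports Main "HOL-Number_Theory.Cong"
begin

text \<open>
  A partition is the weakly decreasing list of its (positive) parts. Rows and columns of the
  diagram are numbered from 1, so the part \<open>\<lambda>\<^sub>j\<close> is the list entry \<open>lam ! (j - 1)\<close>.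
\<close>

definition is_partition :: "nat \<Rightarrow> nat list \<Rightarrow> bool" where
  "is_partition n lam \<longleftrightarrow> sorted_wrt (\<ge>) lam \<and> (\<forall>p\<in>set lam. p > 0) \<and> sum_list lam = n"

definition diagram :: "nat list \<Rightarrow> (nat \<times> nat) set" where
  "diagram lam = {(j, k). 1 \<le> j \<and> j \<le> length lam \<and> 1 \<le> k \<and> k \<le> lam ! (j - 1)}"

text \<open>The list of column lengths; there are \<open>\<lambda>\<^sub>1\<close> columns.\<close>

definition conjugate :: "nat list \<Rightarrow> nat list" where
  "conjugate lam =
     (if lam = [] then [] else map (\<lambda>k. card {j. (j, k) \<in> diagram lam}) [1..<hd lam + 1])"

lemma diagram_conjugate:
  assumes "is_partition n lam"
  shows "diagram (conjugate lam) = prod.swap ` diagram lam"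
proof (cases "lam = []")
  case True
  then show ?thesis by (auto simp: conjugate_def diagram_def)
next
  case False
  have mono: "lam ! j \<le> lam ! i" if "i \<le> j" "j < length lam" for i j
    using assms that by (cases "i = j") (auto simp: is_partition_def sorted_wrt_iff_nth_less)
  define c where "c k = card {j. (j, k) \<in> diagram lam}" for k
  have col: "(j, k) \<in> diagram lam \<longleftrightarrow> 1 \<le> j \<and> j \<le> c k" if k: "1 \<le> k" for j k
  proof -
    let ?C = "{j. (j, k) \<in> diagram lam}"
    have fin: "finite ?C"
      by (rule finite_subset[of _ "{..length lam}"]) (auto simp: diagram_def)
    have down: "i \<in> ?C" if "j \<in> ?C" "1 \<le> i" "i \<le> j" for i j
    proof -
      have "lam ! (j - 1) \<le> lam ! (i - 1)"
        using that by (intro mono) (auto simp: diagram_def)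
      then show ?thesis using that by (auto simp: diagram_def)
    qed
    have "?C = {1..c k}"
    proof (cases "?C = {}")
      case True
      then show ?thesis by (simp add: c_def)
    next
      case False
      have "?C = {1..Max ?C}"
      proof
        show "?C \<subseteq> {1..Max ?C}"
          using fin by (auto simp: Max_ge) (simp add: diagram_def)
        show "{1..Max ?C} \<subseteq> ?C"
          using down[OF Max_in[OF fin False]] by auto
      qed
      then show ?thesis unfolding c_def by (metis card_atLeastAtMost diff_Suc_1)
    qed
    then show ?thesis by auto
  qed
  have nth: "conjugate lam ! (k - 1) = c k" if "1 \<le> k" "k \<le> hd lam" for k
    using False that by (auto simp: conjugate_def c_def simp del: upt_Suc)
  have len: "length (conjugate lam) = hd lam"
    using False by (simp add: conjugate_def del: upt_Suc)
  have bound: "k \<le> hd lam" if "(j, k) \<in> diagram lam" for j k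
  proof -
    have "lam ! (j - 1) \<le> lam ! 0"
      using that by (intro mono) (auto simp: diagram_def)
    then show ?thesis using that False by (auto simp: diagram_def hd_conv_nth)
  qed
  have "(k, j) \<in> diagram (conjugate lam) \<longleftrightarrow> (j, k) \<in> diagram lam" for j k
  proof (cases "1 \<le> k \<and> k \<le> hd lam")
    case True
    then have "(k, j) \<in> diagram (conjugate lam) \<longleftrightarrow> 1 \<le> j \<and> j \<le> c k"
      unfolding diagram_def[of "conjugate lam"] using nth[of k] len by auto
    then show ?thesis using col[of k j] True by auto
  next
    case False
    then show ?thesis using bound[of j k] len by (auto simp: diagram_def)
  qed
  then show ?thesis by (force simp: image_iff)
qed

definition hook_length :: "nat list \<Rightarrow> nat \<Rightarrow> nat \<Rightarrow> int" where
  "hook_length lam j k =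
     int (lam ! (j - 1)) + int (conjugate lam ! (k - 1)) - int j - int k + 1"

definition is_core :: "nat \<Rightarrow> nat list \<Rightarrow> bool" where
  "is_core t lam \<longleftrightarrow> (\<forall>(j, k)\<in>diagram lam. \<not> int t dvd hook_length lam j k)"

definition SC :: "nat \<Rightarrow> nat \<Rightarrow> nat list set" where
  "SC t n = {lam. is_partition n lam \<and> is_core t lam \<and> conjugate lam = lam}"

definition S6 :: "nat \<Rightarrow> (int \<times> int \<times> int) set" where
  "S6 n = {(x, y, z). x\<^sup>2 + y\<^sup>2 + z\<^sup>2 = 24 * int n + 35 \<and>
     ([x = 1] (mod 12) \<or> [x = - 1] (mod 12)) \<and>
     ([y = 3] (mod 12) \<or> [y = - 3] (mod 12)) \<and>
     ([z = 5] (mod 12) \<or> [z = - 5] (mod 12))}"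

definition sign_rel :: "(int \<times> int \<times> int) set \<Rightarrow> ((int \<times> int \<times> int) \<times> (int \<times> int \<times> int)) set" where
  "sign_rel A = {((x, y, z), (x', y', z')). (x, y, z) \<in> A \<and> (x', y', z') \<in> A \<and>
     (x' = x \<or> x' = - x) \<and> (y' = y \<or> y' = - y) \<and> (z' = z \<or> z' = - z)}"

lemma equiv_sign_rel: "equiv A (sign_rel A)"
  by (rule equivI) (auto simp: sign_rel_def refl_on_def sym_on_def trans_on_def)

end

theory Submission
  imports Defs "HOL-Library.Infinite_Set"
begin

text \<open>
  Encode a self-conjugate partition by its bead set \<open>B\<close>, the integers \<open>\<lambda>\<^sub>j - j\<close> with rows numbered
  from 0 (and \<open>\<lambda>\<^sub>j = 0\<close> beyond the last part). Self-conjugacy says that exactly one of \<open>m\<close> and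
  \<open>1 - m\<close> lies in \<open>B\<close>. The hook length of a cell \<open>(j, k)\<close> is the sum of the beads of rows \<open>j\<close> and
  \<open>k\<close> minus 1, so the partition is a 6-core iff \<open>B - 6 \<subseteq> B\<close>. Such a \<open>B\<close> is determined by the
  thresholds \<open>a, b, c\<close> below which \<open>6 i + 1\<close>, \<open>6 i + 2\<close>, \<open>6 i + 3\<close> lie in \<open>B\<close>, the residues 0, 5, 4
  being their mirror images. Summing the diagonal hooks, i.e. \<open>2 m - 1\<close> over the positive beads \<open>m\<close>,
  gives \<open>n = (6 a\<^sup>2 - 5 a) + (6 b\<^sup>2 - 3 b) + (6 c\<^sup>2 - c)\<close>; completing squares,
  \<open>24 n + 35 = (12 c - 1)\<^sup>2 + (12 b - 3)\<^sup>2 + (12 a - 5)\<^sup>2\<close>. Every sign class in \<open>S6 n\<close> contains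
  exactly one triple congruent to \<open>(-1, -3, -5)\<close> modulo 12.
\<close>

section \<open>Self-conjugate shapes and their bead sets\<close>

text \<open>Here \<open>k < p j\<close> stands for a cell in row \<open>j\<close> and column
  \<open>k\<close>, both counted from 0. Symmetry alone makes \<open>p\<close> weakly decreasing and
  zero from \<open>p 0\<close> on, so this captures exactly the self-conjugate shapes.\<close>

definition symmetric_rows :: "(nat \<Rightarrow> nat) \<Rightarrow> bool" where
  "symmetric_rows p \<longleftrightarrow> (\<forall>j k. k < p j \<longleftrightarrow> j < p k)"

definition bead :: "(nat \<Rightarrow> nat) \<Rightarrow> nat \<Rightarrow> int" where
  "bead p j = int (p j) - int j"

text \<open>These are the Maya diagrams of charge 0 that are symmetric under \<open>m\<close> to
  \<open>1 - m\<close>. The upper bound and the symmetry together put all sufficiently small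
  integers into \<open>B\<close>.\<close>

definition balanced :: "int set \<Rightarrow> bool" where
  "balanced B \<longleftrightarrow> (\<forall>m. m \<in> B \<longleftrightarrow> 1 - m \<notin> B) \<and> bdd_above B"

definition weight :: "int set \<Rightarrow> int" where
  "weight B = (\<Sum>b | b \<in> B \<and> 0 < b. 2 * b - 1)"

definition count_above :: "int set \<Rightarrow> int \<Rightarrow> nat" where
  "count_above B m = card {b \<in> B. m < b}"

lemma balanced_iff: "balanced B \<Longrightarrow> m \<in> B \<longleftrightarrow> 1 - m \<notin> B"
  unfolding balanced_def by (elim conjE) (erule spec)

lemma balanced_bdd_above: "balanced B \<Longrightarrow> bdd_above B"
  unfolding balanced_def by (rule conjunct2)

lemma symmetric_rowsD: "symmetric_rows p \<Longrightarrow> k < p j \<longleftrightarrow> j < p k"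
  by (simp add: symmetric_rows_def)

lemma symmetric_rows_antimono:
  assumes "symmetric_rows p" "i \<le> j"
  shows "p j \<le> p i"
  using symmetric_rowsD[OF assms(1)] assms(2) by (meson leI le_less_trans less_irrefl)

lemma symmetric_rows_eq_0:
  assumes "symmetric_rows p" "p 0 \<le> j"
  shows "p j = 0"
  using symmetric_rowsD[OF assms(1), of 0 j] assms(2) by simp

lemma bead_strict:
  assumes "symmetric_rows p" "i < j"
  shows "bead p j < bead p i"
  using symmetric_rows_antimono[OF assms(1), of i j] assms(2) by (simp add: bead_def)

text \<open>For a cell both row lengths exceed the opposite index, otherwise neither does. The sum 1
  is therefore never attained, so \<open>m\<close> and \<open>1 - m\<close> cannot both be
  beads.\<close>

lemma bead_add_bead:
  assumes "symmetric_rows p"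
  shows "k < p j \<Longrightarrow> 2 \<le> bead p j + bead p k"
    and "\<not> k < p j \<Longrightarrow> bead p j + bead p k \<le> 0"
  using symmetric_rowsD[OF assms, of k j] by (auto simp: bead_def)

text \<open>
  If \<open>m\<close> is not a bead, let \<open>j\<close> be the first row whose bead is less than \<open>m\<close>; column \<open>j + m - 1\<close>
  then has length exactly \<open>j\<close>, and by symmetry that row has bead \<open>1 - m\<close>.
\<close>

lemma bead_or_dual_bead:
  assumes p: "symmetric_rows p" and m: "1 \<le> m"
  shows "m \<in> range (bead p) \<or> 1 - m \<in> range (bead p)"
proof (rule disjCI)
  assume "1 - m \<notin> range (bead p)"
  have ex: "bead p (p 0) < m"
    using symmetric_rows_eq_0[OF p, of "p 0"] m by (simp add: bead_def)
  define j where "j = (LEAST j. bead p j < m)"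
  have j: "bead p j < m"
    unfolding j_def using ex by (rule LeastI)
  show "m \<in> range (bead p)"
  proof (rule ccontr)
    assume m': "m \<notin> range (bead p)"
    have less: "m < bead p i" if "i < j" for i
      using not_less_Least[of i "\<lambda>j. bead p j < m"] that m'
      by (metis j_def linorder_neqE rangeI)
    define k where "k = nat (int j + m - 1)"
    have k: "int k = int j + m - 1"
      using m by (simp add: k_def)
    have "\<not> k < p j"
      using j k by (simp add: bead_def)
    then have "p k \<le> j"
      using symmetric_rowsD[OF p, of k j] by simp
    moreover have "j \<le> p k"
    proof (cases j)
      case (Suc i)
      then have "k < p i"
        using less[of i] k by (simp add: bead_def)
      then show ?thesis
        using symmetric_rowsD[OF p, of k i] Suc by simp
    qed simp
    ultimately have "bead p k = 1 - m"
      using k by (simp add: bead_def)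
    then show False
      using \<open>1 - m \<notin> range (bead p)\<close> by (metis rangeI)
  qed
qed

lemma balanced_range_bead:
  assumes p: "symmetric_rows p"
  shows "balanced (range (bead p))"
  unfolding balanced_def
proof (intro conjI allI)
  fix m
  have "\<not> (m \<in> range (bead p) \<and> 1 - m \<in> range (bead p))"
  proof
    assume "m \<in> range (bead p) \<and> 1 - m \<in> range (bead p)"
    then obtain j k where "m = bead p j" "1 - m = bead p k"
      by blast
    then show False
      using bead_add_bead[OF p, of k j] by linarith
  qed
  \<comment> \<open>One of \<open>m\<close> and \<open>1 - m\<close> is at least 1, as the preceding
    lemma requires.\<close>
  moreover have "m \<in> range (bead p) \<or> 1 - m \<in> range (bead p)"
    using bead_or_dual_bead[OF p, of m] bead_or_dual_bead[OF p, of "1 - m"] by force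
  ultimately show "m \<in> range (bead p) \<longleftrightarrow> 1 - m \<notin> range (bead p)"
    by blast
next
  have "bead p j \<le> bead p 0" for j
    using bead_strict[OF p, of 0 j] by (cases "j = 0") auto
  then show "bdd_above (range (bead p))"
    by (auto intro: bdd_aboveI[of _ "bead p 0"])
qed

section \<open>Recovering the shape from a balanced set\<close>

lemma finite_above:
  assumes "bdd_above (B :: int set)"
  shows "finite {b \<in> B. m < b}"
proof -
  obtain M where "\<And>b. b \<in> B \<Longrightarrow> b \<le> M"
    using assms by (auto simp: bdd_above_def)
  then show ?thesis
    by (auto intro: finite_subset[OF _ finite_atLeastAtMost[of m M]])
qed

lemma count_above_strict_anti:
  assumes "strict_antimono_on UNIV e"
  shows "count_above (range e) (e j) = j"
proof -
  have "e j < e i \<longleftrightarrow> i < j" for i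
    using assms unfolding monotone_on_def by (metis UNIV_I less_asym linorder_neqE_nat)
  then have "{b \<in> range e. e j < b} = e ` {..<j}"
    by auto
  moreover have "inj e"
    using assms unfolding monotone_on_def
    by (intro injI) (metis UNIV_I less_irrefl linorder_neqE_nat)
  ultimately show ?thesis
    by (simp add: count_above_def card_image inj_on_subset)
qed

lemma less_count_above_iff:
  assumes "strict_antimono_on UNIV e" "bdd_above (range e)"
  shows "k < count_above (range e) m \<longleftrightarrow> m < e k"
proof (cases "m < e k")
  case True
  then have "{b \<in> range e. e k < b} \<subset> {b \<in> range e. m < b}"
    by force
  then have "count_above (range e) (e k) < count_above (range e) m"
    unfolding count_above_def by (intro psubset_card_mono finite_above assms)
  then show ?thesis
    using True count_above_strict_anti[OF assms(1), of k] by simp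
next
  case False
  then have "count_above (range e) m \<le> count_above (range e) (e k)"
    unfolding count_above_def by (intro card_mono finite_above assms) auto
  then show ?thesis
    using False count_above_strict_anti[OF assms(1), of k] by simp
qed

lemma count_above_pred:
  assumes "bdd_above B"
  shows "count_above B (m - 1) = count_above B m + of_bool (m \<in> B)"
proof (cases "m \<in> B")
  case True
  then have "{b \<in> B. m - 1 < b} = insert m {b \<in> B. m < b}"
    by auto
  then show ?thesis
    using True finite_above[OF assms, of m] by (simp add: count_above_def)
next
  case False
  then have "{b \<in> B. m - 1 < b} = {b \<in> B. m < b}"
    by (metis (lifting) zle_diff1_eq linorder_not_less order_le_less)
  then show ?thesis
    using False by (simp add: count_above_def)
qed

text \<open>For \<open>m >= 0\<close> the integers above \<open>- m\<close> and up to
  \<open>m\<close> split into \<open>m\<close> pairs \<open>{i, 1 - i}\<close>, and each pair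
  contributes exactly one element of \<open>B\<close>. Negative \<open>m\<close> follows by
  exchanging \<open>m\<close> and \<open>- m\<close>.\<close>

lemma count_above_uminus:
  assumes "balanced B"
  shows "int (count_above B (- m)) = int (count_above B m) + m"
proof -
  note bdd = balanced_bdd_above[OF assms]
  have *: "int (count_above B (- int k)) = int (count_above B (int k)) + int k" for k
  proof (induction k)
    case (Suc k)
    have "- int k \<in> B \<longleftrightarrow> int k + 1 \<notin> B"
      using balanced_iff[OF assms, of "- int k"] by (simp add: add.commute)
    then show ?case
      using Suc count_above_pred[OF bdd, of "- int k"] count_above_pred[OF bdd, of "int k + 1"]
      by (auto simp: algebra_simps minus_diff_commute)
  qed simp
  show ?thesis
    using *[of "nat m"] *[of "nat (- m)"] by (cases "0 \<le> m") auto
qed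

text \<open>For the bead \<open>m\<close> of row \<open>j\<close> the right-hand side is
  \<open>j + m\<close>, the length of that row; so row lengths can be read off \<open>B\<close> by
  counting.\<close>

lemma count_above_dual:
  assumes "balanced B" "m \<in> B"
  shows "int (count_above B (1 - m)) = int (count_above B m) + m"
  using assms(2) count_above_uminus[OF assms(1), of "m - 1"]
    count_above_pred[OF balanced_bdd_above[OF assms(1)], of m] by simp

text \<open>Reflecting \<open>B\<close> at an upper bound \<open>M\<close> gives an infinite set of
  naturals, whose increasing enumeration reflects back to a decreasing one.\<close>

lemma ex_strict_anti_enumeration:
  assumes "bdd_above (B :: int set)" "\<And>m. \<exists>b\<in>B. b < m"
  shows "\<exists>e :: nat \<Rightarrow> int. strict_antimono_on UNIV e \<and> range e = B"
proof -
  obtain M where M: "\<And>b. b \<in> B \<Longrightarrow> b \<le> M"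
    using assms(1) by (auto simp: bdd_above_def)
  define S where "S = {s::nat. M - int s \<in> B}"
  have "\<exists>s>k. s \<in> S" for k
  proof -
    obtain b where "b \<in> B" "b < M - int k"
      using assms(2) by blast
    then show ?thesis
      by (intro exI[of _ "nat (M - b)"]) (auto simp: S_def)
  qed
  then have S: "infinite S"
    by (simp add: infinite_nat_iff_unbounded)
  define e where "e j = M - int (enumerate S j)" for j
  have "strict_antimono_on UNIV e"
    using strict_mono_enumerate[OF S] by (auto simp: monotone_on_def e_def strict_mono_def)
  moreover have "range e = B"
  proof -
    have "range e = (\<lambda>s. M - int s) ` range (enumerate S)"
      unfolding e_def by auto
    also have "range (enumerate S) = S"
      by (rule range_enumerate[OF S])
    also have "(\<lambda>s. M - int s) ` S = B"
    proof (intro equalityI subsetI)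
      fix b assume "b \<in> B"
      then show "b \<in> (\<lambda>s. M - int s) ` S"
        using M[of b] by (intro image_eqI[of _ _ "nat (M - b)"]) (auto simp: S_def)
    qed (auto simp: S_def)
    finally show ?thesis .
  qed
  ultimately show ?thesis
    by blast
qed

lemma ex_symmetric_rows:
  assumes B: "balanced B"
  shows "\<exists>p. symmetric_rows p \<and> range (bead p) = B"
proof -
  note bdd = balanced_bdd_above[OF B]
  from bdd obtain M where M: "\<And>b. b \<in> B \<Longrightarrow> b \<le> M"
    by (auto simp: bdd_above_def)
  have "\<exists>b\<in>B. b < m" for m
  proof -
    \<comment> \<open>The bound \<open>- M\<close> pushes the mirror image \<open>1 - b\<close>
      beyond \<open>M\<close>, hence out of \<open>B\<close>.\<close>
    define b where "b = min (m - 1) (- M)"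
    have "1 - b \<notin> B"
      using M[of "1 - b"] by (auto simp: b_def)
    then show ?thesis
      using balanced_iff[OF B, of b] by (intro bexI[of _ b]) (auto simp: b_def)
  qed
  then obtain e :: "nat \<Rightarrow> int" where e: "strict_antimono_on UNIV e" "range e = B"
    using ex_strict_anti_enumeration[OF bdd] by blast
  \<comment> \<open>row \<open>j\<close> has a cell in column \<open>k\<close> iff the prospective hook length \<open>e j + e k - 1\<close> is positive\<close>
  define p where "p j = count_above B (1 - e j)" for j
  have p: "bead p j = e j" for j
  proof -
    have "int (p j) = int (count_above B (e j)) + e j"
      unfolding p_def using e(2) by (intro count_above_dual[OF B]) auto
    also have "count_above B (e j) = j"
      using count_above_strict_anti[OF e(1)] e(2) by simp
    finally show ?thesis
      by (simp add: bead_def)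
  qed
  have "k < p j \<longleftrightarrow> 1 - e j < e k" for j k
    using less_count_above_iff[OF e(1)] bdd e(2) by (simp add: p_def)
  then have "symmetric_rows p"
    by (auto simp: symmetric_rows_def)
  moreover have "range (bead p) = B"
    using p e(2) by (simp add: image_def)
  ultimately show ?thesis
    by blast
qed

text \<open>The number of larger beads is the row index of a bead, so the set alone tells which bead
  belongs to which row.\<close>

lemma range_bead_inject:
  assumes "symmetric_rows p" "symmetric_rows q" "range (bead p) = range (bead q)"
  shows "p = q"
proof
  fix j
  have anti: "strict_antimono_on UNIV (bead r)" if "symmetric_rows r" for r
    using bead_strict[OF that] by (auto simp: monotone_on_def)
  obtain i where i: "bead p j = bead q i"
    using assms(3) by (metis rangeE rangeI)
  then have "i = j"
    using count_above_strict_anti[OF anti[OF assms(1)], of j]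
      count_above_strict_anti[OF anti[OF assms(2)], of i] assms(3) by simp
  then show "p j = q j"
    using i by (simp add: bead_def)
qed

section \<open>Size and hook lengths in terms of beads\<close>

lemma sum_rows_eq_weight:
  assumes p: "symmetric_rows p"
  shows "int (\<Sum>j<p 0. p j) = weight (range (bead p))"
proof -
  let ?Y = "SIGMA j:{..<p 0}. {..<p j}"
  \<comment> \<open>cut the diagram into its principal hooks\<close>
  let ?H = "\<lambda>j. {j} \<times> {j..<p j} \<union> {j<..<p j} \<times> {j}"
  let ?D = "{j. j < p j}"
  have Y: "?Y = (\<Union>j\<in>?D. ?H j)"
  proof -
    have "(i, k) \<in> ?Y \<longleftrightarrow> k < p i" for i k
    proof -
      have "i < p 0" if "k < p i"
        using that symmetric_rowsD[OF p, of 0 i] by simp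
      then show ?thesis
        by blast
    qed
    \<comment> \<open>A cell lies on the principal hook indexed by the smaller of its coordinates.
      Below the diagonal that hook is cut off by \<open>p k\<close>, so symmetry has to bring back
      \<open>p i\<close>.\<close>
    moreover have "(i, k) \<in> (\<Union>j\<in>?D. ?H j) \<longleftrightarrow> k < p i" for i k
    proof (cases "i \<le> k")
      case True
      then show ?thesis
        by (auto intro!: exI[of _ i])
    next
      case False
      then have "(i, k) \<in> (\<Union>j\<in>?D. ?H j) \<longleftrightarrow> i < p k"
        by (auto intro!: exI[of _ k])
      then show ?thesis
        using symmetric_rowsD[OF p, of k i] by blast
    qed
    ultimately show ?thesis
      by (simp only: set_eq_iff split_paired_all) blast
  qed
  have fin: "finite ?D"
  proof (rule finite_subset)
    show "?D \<subseteq> {..<p 0}"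
      using symmetric_rows_antimono[OF p, of 0] by (auto intro: less_le_trans)
  qed simp
  have "(\<Sum>j<p 0. p j) = card ?Y"
    by simp
  also have "\<dots> = (\<Sum>j\<in>?D. card (?H j))"
    unfolding Y using fin by (intro card_UN_disjoint) auto
  also have "int \<dots> = (\<Sum>j\<in>?D. 2 * bead p j - 1)"
  proof -
    \<comment> \<open>The horizontal arm includes the diagonal cell and has \<open>p j - j\<close>
      cells; the vertical one excludes it and has one fewer.\<close>
    have "int (card (?H j)) = 2 * bead p j - 1" if "j \<in> ?D" for j
    proof -
      have "card (?H j) = card ({j} \<times> {j..<p j}) + card ({j<..<p j} \<times> {j})"
        by (intro card_Un_disjoint) auto
      then show ?thesis
        using that by (simp add: bead_def card_cartesian_product)
    qed
    then show ?thesis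
      by simp
  qed
  also have "\<dots> = weight (range (bead p))"
  proof -
    have "inj (bead p)"
      using bead_strict[OF p] by (intro injI) (metis less_irrefl linorder_neqE_nat)
    moreover have "{b. b \<in> range (bead p) \<and> 0 < b} = bead p ` ?D"
      by (auto simp: bead_def)
    ultimately show ?thesis
      by (simp add: weight_def sum.reindex inj_on_subset)
  qed
  finally show ?thesis .
qed

text \<open>If \<open>b\<close> is a bead and \<open>b - t\<close> is not, then
  \<open>1 - (b - t)\<close> is a bead and these two rows meet in a hook of length \<open>t\<close>.
  Conversely, from a hook of length \<open>t * c\<close>, subtracting \<open>t\<close> from the bead
  of row \<open>j\<close> repeatedly, \<open>c\<close> times, reaches \<open>1 - bead p k\<close>,
  which balance forbids.\<close>

lemma no_hook_dvd_iff:
  assumes p: "symmetric_rows p" and t: "0 < t"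
  shows "(\<forall>j k. k < p j \<longrightarrow> \<not> t dvd bead p j + bead p k - 1) \<longleftrightarrow>
    (\<forall>b\<in>range (bead p). b - t \<in> range (bead p))" (is "?L \<longleftrightarrow> ?R")
proof
  have bal: "m \<in> range (bead p) \<longleftrightarrow> 1 - m \<notin> range (bead p)" for m
    by (rule balanced_iff[OF balanced_range_bead[OF p]])
  {
    assume L: ?L
    show ?R
    proof (intro ballI, rule ccontr)
      fix b assume b: "b \<in> range (bead p)" "b - t \<notin> range (bead p)"
      then obtain j k where jk: "b = bead p j" "1 - (b - t) = bead p k"
        using bal[of "b - t"] by blast
      then have "bead p j + bead p k - 1 = t"
        by simp
      moreover have "k < p j"
        using bead_add_bead(2)[OF p, of k j] jk t by linarith
      ultimately show False
        using L by (metis dvd_refl)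
    qed
  next
    assume R: ?R
    show ?L
    proof (intro allI impI notI)
      fix j k assume jk: "k < p j" "t dvd bead p j + bead p k - 1"
      then obtain c where c: "bead p j + bead p k - 1 = t * c"
        by blast
      moreover have "1 \<le> bead p j + bead p k - 1"
        using bead_add_bead(1)[OF p jk(1)] by simp
      ultimately have "0 < c"
        using t by (metis int_one_le_iff_zero_less zero_less_mult_pos)
      have "bead p j - t * int i \<in> range (bead p)" for i
      proof (induction i)
        case (Suc i)
        then have "bead p j - t * int i - t \<in> range (bead p)"
          using R by blast
        then show ?case
          by (simp add: algebra_simps)
      qed simp
      from this[of "nat c"] have "bead p j - t * c \<in> range (bead p)"
        using \<open>0 < c\<close> by simp
      moreover have "bead p j - t * c = 1 - bead p k"
        using c by simp
      ultimately have "1 - bead p k \<in> range (bead p)"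
        by simp
      then show False
        using bal[of "bead p k"] by blast
    qed
  }
qed

section \<open>From row functions to partitions as lists\<close>

definition row :: "nat list \<Rightarrow> nat \<Rightarrow> nat" where
  "row lam j = (if j < length lam then lam ! j else 0)"

lemma mem_diagram_iff: "(Suc j, Suc k) \<in> diagram lam \<longleftrightarrow> k < row lam j"
  by (auto simp: diagram_def row_def)

lemma symmetric_rows_row:
  assumes "is_partition n lam" "conjugate lam = lam"
  shows "symmetric_rows (row lam)"
proof -
  have "diagram lam = prod.swap ` diagram lam"
    using diagram_conjugate[OF assms(1)] assms(2) by simp
  then have "(j, k) \<in> diagram lam \<longleftrightarrow> (k, j) \<in> diagram lam" for j k
    by (metis image_eqI swap_simp image_iff swap_swap)
  then show ?thesis
    unfolding symmetric_rows_def mem_diagram_iff[symmetric] by blast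
qed

text \<open>Parts are positive, so row \<open>j\<close> exists iff column 0 reaches it, and by
  symmetry column 0 is as long as row 0. Hence the row function also determines the length of the
  list.\<close>

lemma length_eq_row_0:
  assumes "is_partition n lam" "symmetric_rows (row lam)"
  shows "length lam = row lam 0"
proof -
  have "j < length lam \<longleftrightarrow> 0 < row lam j" for j
    using assms(1) by (auto simp: is_partition_def row_def)
  then have "j < length lam \<longleftrightarrow> j < row lam 0" for j
    using symmetric_rowsD[OF assms(2), of 0 j] by simp
  then show ?thesis
    by (metis linorder_neqE_nat less_irrefl)
qed

lemma row_inject:
  assumes "is_partition n lam" "is_partition n' mu" "symmetric_rows (row lam)" "row lam = row mu"
  shows "lam = mu"
proof (rule nth_equalityI)
  show len: "length lam = length mu"
    using length_eq_row_0 assms by metis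
  fix j assume "j < length lam"
  then show "lam ! j = mu ! j"
    using len fun_cong[OF assms(4), of j] by (simp add: row_def)
qed

lemma sum_list_eq_weight:
  assumes "is_partition n lam" "symmetric_rows (row lam)"
  shows "int n = weight (range (bead (row lam)))"
proof -
  have "n = (\<Sum>j<length lam. row lam j)"
    using assms(1) by (simp add: is_partition_def sum_list_sum_nth row_def atLeast0LessThan)
  then show ?thesis
    using length_eq_row_0[OF assms] sum_rows_eq_weight[OF assms(2)] by simp
qed

lemma is_core_iff:
  assumes "symmetric_rows (row lam)" "conjugate lam = lam" "0 < t"
  shows "is_core t lam \<longleftrightarrow>
    (\<forall>b\<in>range (bead (row lam)). b - int t \<in> range (bead (row lam)))"
proof -
  have "is_core t lam \<longleftrightarrow> (\<forall>j k. (Suc j, Suc k) \<in> diagram lam \<longrightarrow>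
      \<not> int t dvd hook_length lam (Suc j) (Suc k))"
  proof
    assume R: "\<forall>j k. (Suc j, Suc k) \<in> diagram lam \<longrightarrow>
      \<not> int t dvd hook_length lam (Suc j) (Suc k)"
    have "\<not> int t dvd hook_length lam j k" if "(j, k) \<in> diagram lam" for j k
    proof -
      have "j = Suc (j - 1)" "k = Suc (k - 1)"
        using that by (auto simp: diagram_def)
      then show ?thesis
        using that R by metis
    qed
    then show "is_core t lam"
      unfolding is_core_def by blast
  qed (auto simp: is_core_def)
  also have "\<dots> \<longleftrightarrow> (\<forall>j k. k < row lam j \<longrightarrow>
      \<not> int t dvd bead (row lam) j + bead (row lam) k - 1)"
  proof -
    \<comment> \<open>Self-conjugacy turns the column length into a row length. Passing to indices
      from 1 subtracts 2 and the hook formula adds 1, leaving the constant -1.\<close>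
    have "hook_length lam (Suc j) (Suc k) = bead (row lam) j + bead (row lam) k - 1"
      if "k < row lam j" for j k
    proof -
      have "j < row lam k"
        using that symmetric_rowsD[OF assms(1)] by simp
      then have "j < length lam" "k < length lam"
        using that by (auto simp: row_def split: if_splits)
      then show ?thesis
        using assms(2) by (simp add: hook_length_def bead_def row_def)
    qed
    then show ?thesis
      by (simp add: mem_diagram_iff cong: imp_cong)
  qed
  also have "\<dots> \<longleftrightarrow> (\<forall>b\<in>range (bead (row lam)). b - int t \<in> range (bead (row lam)))"
    using assms by (intro no_hook_dvd_iff) auto
  finally show ?thesis .
qed

lemma ex_self_conjugate_partition:
  assumes p: "symmetric_rows p"
  shows "\<exists>n lam. is_partition n lam \<and> conjugate lam = lam \<and> row lam = p"
proof -
  \<comment> \<open>By symmetry the rows before \<open>p 0\<close> are exactly the nonempty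
    ones.\<close>
  define lam where "lam = map p [0..<p 0]"
  have row: "row lam = p"
    using symmetric_rows_eq_0[OF p] by (auto simp: row_def lam_def)
  have "is_partition (sum_list lam) lam"
    unfolding is_partition_def
  proof (intro conjI ballI refl)
    show "sorted_wrt (\<ge>) lam"
      using symmetric_rows_antimono[OF p] by (simp add: lam_def sorted_wrt_iff_nth_less)
    fix m assume "m \<in> set lam"
    then obtain j where "m = p j" "j < p 0"
      by (auto simp: lam_def)
    then show "0 < m"
      using symmetric_rowsD[OF p, of j 0] by simp
  qed
  moreover have "conjugate lam = lam"
  proof (cases "p 0 = 0")
    case False
    then have hd: "lam \<noteq> []" "hd lam = p 0"
      by (auto simp: lam_def hd_map)
    have "card {j. (j, Suc k) \<in> diagram lam} = p k" for k
    proof -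
      have "{j. (j, Suc k) \<in> diagram lam} = Suc ` {..<p k}"
      proof (rule set_eqI)
        fix j
        show "j \<in> {j. (j, Suc k) \<in> diagram lam} \<longleftrightarrow> j \<in> Suc ` {..<p k}"
        proof (cases j)
          case (Suc i)
          then show ?thesis
            using symmetric_rowsD[OF p, of k i] by (auto simp: mem_diagram_iff row)
        qed (auto simp: diagram_def)
      qed
      then show ?thesis
        by (simp add: card_image)
    qed
    then show ?thesis
      using hd by (intro nth_equalityI) (auto simp: conjugate_def lam_def simp del: upt_Suc)
  qed (simp add: lam_def conjugate_def)
  ultimately show ?thesis
    using row by blast
qed

definition core_beads :: "nat \<Rightarrow> nat \<Rightarrow> int set set" where
  "core_beads t n = {B. balanced B \<and> (\<forall>b\<in>B. b - int t \<in> B) \<and> weight B = int n}"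

lemma bij_betw_SC_core_beads:
  assumes t: "0 < t"
  shows "bij_betw (\<lambda>lam. range (bead (row lam))) (SC t n) (core_beads t n)"
  unfolding bij_betw_def
proof (intro conjI inj_onI equalityI subsetI)
  fix lam mu assume "lam \<in> SC t n" "mu \<in> SC t n" "range (bead (row lam)) = range (bead (row mu))"
  then show "lam = mu"
    using symmetric_rows_row range_bead_inject row_inject unfolding SC_def by blast
next
  fix B assume "B \<in> (\<lambda>lam. range (bead (row lam))) ` SC t n"
  then obtain lam where lam: "B = range (bead (row lam))" "is_partition n lam" "is_core t lam"
    "conjugate lam = lam"
    by (auto simp: SC_def)
  then show "B \<in> core_beads t n"
    using symmetric_rows_row[OF lam(2,4)] is_core_iff[OF _ lam(4) t] balanced_range_bead
      sum_list_eq_weight[OF lam(2)] unfolding core_beads_def by auto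
next
  fix B assume B: "B \<in> core_beads t n"
  then obtain p where p: "symmetric_rows p" "range (bead p) = B"
    using ex_symmetric_rows[of B] by (auto simp: core_beads_def)
  then obtain m lam where lam: "is_partition m lam" "conjugate lam = lam" "row lam = p"
    using ex_self_conjugate_partition by blast
  have "m = n"
    using sum_list_eq_weight[OF lam(1)] lam(3) p B by (simp add: core_beads_def)
  moreover have "is_core t lam"
    using is_core_iff[OF _ lam(2) t] lam(3) p B by (auto simp: core_beads_def)
  ultimately show "B \<in> (\<lambda>lam. range (bead (row lam))) ` SC t n"
    using lam p by (auto simp: SC_def)
qed

section \<open>Threshold triples for the residues modulo 6\<close>

definition runner :: "int \<Rightarrow> int \<Rightarrow> int set" where
  "runner r a = {6 * i + r |i. i < a} \<union> {1 - (6 * i + r) |i. a \<le> i}"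

definition runners :: "int \<times> int \<times> int \<Rightarrow> int set" where
  "runners = (\<lambda>(a, b, c). runner 1 a \<union> runner 2 b \<union> runner 3 c)"

lemma mem_runner_iff:
  "m \<in> runner r a \<longleftrightarrow> (\<exists>i. m = 6 * i + r \<and> i < a) \<or> (\<exists>i. m = 1 - (6 * i + r) \<and> a \<le> i)"
  by (auto simp: runner_def)

text \<open>Trading the quantifier for divisibility leaves membership to linear integer
  arithmetic.\<close>

lemma mem_runner_iff_dvd:
  "m \<in> runner r a \<longleftrightarrow> 6 dvd m - r \<and> m - r < 6 * a \<or> 6 dvd m + r - 1 \<and> m + r - 1 \<le> - 6 * a"
proof -
  have "(\<exists>i. m = 6 * i + r \<and> i < a) \<longleftrightarrow> 6 dvd m - r \<and> m - r < 6 * a"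
    by (auto simp: dvd_def algebra_simps)
  moreover have "(\<exists>i. m = 1 - (6 * i + r) \<and> a \<le> i) \<longleftrightarrow> 6 dvd m + r - 1 \<and> m + r - 1 \<le> - 6 * a"
  proof (intro iffI conjI; (elim exE conjE)?)
    assume "6 dvd m + r - 1" "m + r - 1 \<le> - 6 * a"
    then show "\<exists>i. m = 1 - (6 * i + r) \<and> a \<le> i"
      by (intro exI[of _ "- ((m + r - 1) div 6)"]) auto
  qed auto
  ultimately show ?thesis
    unfolding mem_runner_iff by blast
qed

text \<open>The six forms exhaust the residues modulo 6 and are exchanged in pairs by
  \<open>m\<close> to \<open>1 - m\<close>. Duality and the shift by 6 thus become comparisons of
  \<open>i\<close> with a threshold.\<close>

lemma mem_runners_iff:
  "6 * i + 1 \<in> runners (a, b, c) \<longleftrightarrow> i < a"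
  "6 * i + 2 \<in> runners (a, b, c) \<longleftrightarrow> i < b"
  "6 * i + 3 \<in> runners (a, b, c) \<longleftrightarrow> i < c"
  "- 6 * i \<in> runners (a, b, c) \<longleftrightarrow> a \<le> i"
  "- 6 * i - 1 \<in> runners (a, b, c) \<longleftrightarrow> b \<le> i"
  "- 6 * i - 2 \<in> runners (a, b, c) \<longleftrightarrow> c \<le> i"
  by (auto simp: runners_def mem_runner_iff_dvd; presburger)+

lemma int_cases_6:
  fixes m :: int
  obtains i where "m = 6 * i + 1" | i where "m = 6 * i + 2" | i where "m = 6 * i + 3"
    | i where "m = - 6 * i" | i where "m = - 6 * i - 1" | i where "m = - 6 * i - 2"
proof -
  have "m mod 6 = 0 \<or> m mod 6 = 1 \<or> m mod 6 = 2 \<or> m mod 6 = 3 \<or> m mod 6 = 4 \<or> m mod 6 = 5"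
    by presburger
  \<comment> \<open>With \<open>q = m div 6\<close>, residues 5 and 4 are
    \<open>6 * (q + 1) - 1\<close> and \<open>6 * (q + 1) - 2\<close>, hence the extra
    \<open>- 1\<close> in their witness.\<close>
  then show ?thesis
    using that(1-3)[of "m div 6"] that(4)[of "- (m div 6)"] that(5,6)[of "- (m div 6) - 1"]
      mult_div_mod_eq[of 6 m] by (elim disjE) simp_all
qed

lemma runners_dual: "1 - m \<in> runners (a, b, c) \<longleftrightarrow> m \<notin> runners (a, b, c)"
proof -
  have *: "1 - (6 * i + 1) = - 6 * i" "1 - (6 * i + 2) = - 6 * i - 1" "1 - (6 * i + 3) = - 6 * i - 2"
    "1 - (- 6 * i) = 6 * i + 1" "1 - (- 6 * i - 1) = 6 * i + 2" "1 - (- 6 * i - 2) = 6 * i + 3"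
    for i :: int by simp_all
  show ?thesis
    by (cases m rule: int_cases_6) (simp_all only: * mem_runners_iff not_less not_le)
qed

lemma balanced_runners: "balanced (runners (a, b, c))"
  unfolding balanced_def
proof (intro conjI allI)
  fix m
  show "m \<in> runners (a, b, c) \<longleftrightarrow> 1 - m \<notin> runners (a, b, c)"
    unfolding runners_dual by blast
next
  show "bdd_above (runners (a, b, c))"
    by (rule bdd_aboveI[of _ "6 * (\<bar>a\<bar> + \<bar>b\<bar> + \<bar>c\<bar>) + 3"]) (auto simp: runners_def mem_runner_iff)
qed

lemma runners_diff_6:
  assumes "m \<in> runners (a, b, c)"
  shows "m - 6 \<in> runners (a, b, c)"
proof -
  have *: "6 * i + 1 - 6 = 6 * (i - 1) + 1" "6 * i + 2 - 6 = 6 * (i - 1) + 2"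
    "6 * i + 3 - 6 = 6 * (i - 1) + 3" "- 6 * i - 6 = - 6 * (i + 1)"
    "- 6 * i - 1 - 6 = - 6 * (i + 1) - 1" "- 6 * i - 2 - 6 = - 6 * (i + 1) - 2" for i :: int
    by simp_all
  show ?thesis
    using assms by (cases m rule: int_cases_6) (simp_all only: * mem_runners_iff)
qed

lemma inj_runners: "inj runners"
proof (rule injI)
  fix u v assume "runners u = runners v"
  moreover obtain a b c a' b' c' where uv: "u = (a, b, c)" "v = (a', b', c')"
    by (metis prod_cases3)
  ultimately have eq: "runners (a, b, c) = runners (a', b', c')"
    by simp
  have "i < a \<longleftrightarrow> i < a'" "i < b \<longleftrightarrow> i < b'" "i < c \<longleftrightarrow> i < c'" for i
    using mem_runners_iff(1-3)[of i a b c] mem_runners_iff(1-3)[of i a' b' c'] eq by simp_all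
  then show "u = v"
    unfolding uv by (metis less_irrefl linorder_neqE)
qed

text \<open>The threshold is the first integer from \<open>x\<close> upwards that is missing from
  \<open>A\<close>; the point \<open>y\<close> ensures that there is one.\<close>

lemma int_down_closed_eq_lessThan:
  fixes A :: "int set"
  assumes down: "\<And>i. i \<in> A \<Longrightarrow> i - 1 \<in> A" and xy: "x \<in> A" "y \<notin> A"
  shows "\<exists>a. \<forall>i. i \<in> A \<longleftrightarrow> i < a"
proof -
  have below: "i \<in> A" if "j \<in> A" "i \<le> j" for i j
    using that(2,1) by (induction rule: int_le_induct) (auto intro: down)
  then have "x < y"
    using xy by (meson not_le)
  then have ex: "x + int (nat (y - x)) \<notin> A"
    using xy by simp
  define k where "k = (LEAST k. x + int k \<notin> A)"
  have k: "x + int k \<notin> A"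
    unfolding k_def by (rule LeastI[where P = "\<lambda>k. x + int k \<notin> A", OF ex])
  have "i \<in> A" if "i < x + int k" for i
  proof (cases "i \<le> x")
    case False
    then have "x + int (nat (i - x)) \<in> A"
      using that not_less_Least[of "nat (i - x)" "\<lambda>k. x + int k \<notin> A"] by (simp add: k_def)
    then show ?thesis
      using False by simp
  qed (use below xy in blast)
  moreover have "i < x + int k" if "i \<in> A" for i
    using below[OF that] k by (meson not_le)
  ultimately show ?thesis
    by blast
qed

text \<open>Each residue class of \<open>B\<close> is closed downwards, and the upper bound and
  balance make it neither full nor empty, so it has a threshold. Balance then fixes the other three
  classes.\<close>

lemma ex_runners:
  assumes B: "balanced B" and core: "\<And>b. b \<in> B \<Longrightarrow> b - 6 \<in> B"
  shows "\<exists>u. runners u = B"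
proof -
  have bal: "m \<in> B \<longleftrightarrow> 1 - m \<notin> B" for m
    by (rule balanced_iff[OF B])
  obtain M where M: "\<And>b. b \<in> B \<Longrightarrow> b \<le> M"
    using balanced_bdd_above[OF B] by (auto simp: bdd_above_def)
  have ex: "\<exists>a. \<forall>i. 6 * i + r \<in> B \<longleftrightarrow> i < a" for r
  proof -
    let ?A = "{i. 6 * i + r \<in> B}"
    have "\<exists>a. \<forall>i. i \<in> ?A \<longleftrightarrow> i < a"
    proof (rule int_down_closed_eq_lessThan)
      show "i - 1 \<in> ?A" if "i \<in> ?A" for i
        using core[of "6 * i + r"] that by (simp add: algebra_simps)
      \<comment> \<open>The mirror image of the resulting integer exceeds \<open>M\<close>; the term
        in \<open>r\<close> absorbs the offset of the residue class.\<close>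
      show "- (\<bar>M\<bar> + \<bar>r\<bar>) \<in> ?A"
        using bal[of "6 * - (\<bar>M\<bar> + \<bar>r\<bar>) + r"] M[of "1 - (6 * - (\<bar>M\<bar> + \<bar>r\<bar>) + r)"] by auto
      show "\<bar>M\<bar> + \<bar>r\<bar> + 1 \<notin> ?A"
        using M[of "6 * (\<bar>M\<bar> + \<bar>r\<bar> + 1) + r"] by auto
    qed
    then show ?thesis
      by simp
  qed
  obtain a b c where abc: "\<And>i. 6 * i + 1 \<in> B \<longleftrightarrow> i < a" "\<And>i. 6 * i + 2 \<in> B \<longleftrightarrow> i < b"
    "\<And>i. 6 * i + 3 \<in> B \<longleftrightarrow> i < c"
    using ex[of 1] ex[of 2] ex[of 3] by blast
  have dual: "- 6 * i \<in> B \<longleftrightarrow> a \<le> i" "- 6 * i - 1 \<in> B \<longleftrightarrow> b \<le> i" "- 6 * i - 2 \<in> B \<longleftrightarrow> c \<le> i" for i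
    using bal[of "- 6 * i"] bal[of "- 6 * i - 1"] bal[of "- 6 * i - 2"] abc[of i]
    by (simp_all add: add.commute not_less)
  have "m \<in> runners (a, b, c) \<longleftrightarrow> m \<in> B" for m
    by (cases m rule: int_cases_6) (simp_all only: mem_runners_iff abc dual)
  then show ?thesis
    by blast
qed

section \<open>Weights of the runners\<close>

lemma sum_runner_nonneg:
  "(\<Sum>i\<in>{0..<int k}. 2 * (6 * i + r) - 1) = 6 * (int k)\<^sup>2 - (7 - 2 * r) * int k"
proof (induction k)
  case (Suc k)
  have "{0..<int (Suc k)} = insert (int k) {0..<int k}"
    by auto
  then show ?case
    using Suc by (simp add: power2_eq_square algebra_simps)
qed simp

lemma sum_runner_neg:
  "(\<Sum>i\<in>{- int k..<0}. 2 * (1 - (6 * i + r)) - 1) = 6 * (int k)\<^sup>2 + (7 - 2 * r) * int k"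
proof (induction k)
  case (Suc k)
  have "{- int (Suc k)..<0} = insert (- int k - 1) {- int k..<0}"
    by auto
  then show ?case
    using Suc by (simp add: power2_eq_square algebra_simps)
qed simp

text \<open>The sign of \<open>a\<close> decides which half of the runner holds positive beads: the
  class of \<open>r\<close> for \<open>0 <= i < a\<close>, or the mirrored class for
  \<open>a <= i < 0\<close>. Substituting \<open>k = a\<close> or \<open>k = - a\<close> in the two
  sums yields the same quadratic.\<close>

lemma weight_runner:
  assumes "1 \<le> r" "r \<le> 3"
  shows "weight (runner r a) = 6 * a\<^sup>2 - (7 - 2 * r) * a"
proof (cases "0 \<le> a")
  case True
  then have "{m. m \<in> runner r a \<and> 0 < m} = (\<lambda>i. 6 * i + r) ` {0..<a}"
    using assms by (force simp: mem_runner_iff)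
  then have "weight (runner r a) = (\<Sum>i\<in>{0..<a}. 2 * (6 * i + r) - 1)"
    by (simp add: weight_def sum.reindex inj_on_def)
  then show ?thesis
    using sum_runner_nonneg[where k = "nat a" and r = r] True by simp
next
  case False
  then have "{m. m \<in> runner r a \<and> 0 < m} = (\<lambda>i. 1 - (6 * i + r)) ` {a..<0}"
    using assms by (force simp: mem_runner_iff)
  then have "weight (runner r a) = (\<Sum>i\<in>{a..<0}. 2 * (1 - (6 * i + r)) - 1)"
    by (simp add: weight_def sum.reindex inj_on_def)
  then show ?thesis
    using sum_runner_neg[where k = "nat (- a)" and r = r] False by simp
qed

lemma weight_Un:
  assumes "bdd_above A" "bdd_above B" "A \<inter> B = {}"
  shows "weight (A \<union> B) = weight A + weight B"
proof -
  have "{b. b \<in> A \<union> B \<and> 0 < b} = {b \<in> A. 0 < b} \<union> {b \<in> B. 0 < b}"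
    by auto
  then show ?thesis
    unfolding weight_def using assms by (subst sum.union_disjoint[symmetric]) (auto intro: finite_above)
qed

lemma weight_runners:
  "weight (runners (a, b, c)) = 6 * a\<^sup>2 - 5 * a + (6 * b\<^sup>2 - 3 * b) + (6 * c\<^sup>2 - c)"
proof -
  have bdd: "bdd_above (runner 1 a)" "bdd_above (runner 2 b)" "bdd_above (runner 3 c)"
    using balanced_bdd_above[OF balanced_runners[of a b c]] unfolding runners_def prod.case
    by (auto elim: bdd_above_mono)
  have disj: "runner 1 a \<inter> runner 2 b = {}" "(runner 1 a \<union> runner 2 b) \<inter> runner 3 c = {}"
    by (auto simp: mem_runner_iff_dvd; presburger)+
  show ?thesis
    using bdd disj by (simp add: runners_def weight_Un weight_runner)
qed

section \<open>Threshold triples and sign classes\<close>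

text \<open>The order is reversed because the linear terms 5, 3, 1 in the weights of
  \<open>a\<close>, \<open>b\<close>, \<open>c\<close> become the offsets of the squares; completing
  them costs 25 + 9 + 1 = 35.\<close>

definition square_triples :: "nat \<Rightarrow> (int \<times> int \<times> int) set" where
  "square_triples n = {(a, b, c).
     (12 * c - 1)\<^sup>2 + (12 * b - 3)\<^sup>2 + (12 * a - 5)\<^sup>2 = 24 * int n + 35}"

lemma bij_betw_runners: "bij_betw runners (square_triples n) (core_beads 6 n)"
proof -
  have iff: "u \<in> square_triples n \<longleftrightarrow> weight (runners u) = int n" for u
  proof (cases u)
    case (fields a b c)
    have "(12 * c - 1)\<^sup>2 + (12 * b - 3)\<^sup>2 + (12 * a - 5)\<^sup>2 = 24 * weight (runners u) + 35"
      unfolding fields weight_runners by (simp add: power2_eq_square algebra_simps)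
    then show ?thesis
      by (simp add: square_triples_def fields)
  qed
  have "runners ` square_triples n = core_beads 6 n"
  proof (intro equalityI subsetI)
    fix B assume "B \<in> runners ` square_triples n"
    then show "B \<in> core_beads 6 n"
      using balanced_runners runners_diff_6 by (auto simp: core_beads_def iff)
  next
    fix B assume B: "B \<in> core_beads 6 n"
    then obtain u where "runners u = B"
      using ex_runners[of B] by (auto simp: core_beads_def)
    then show "B \<in> runners ` square_triples n"
      using B iff[of u] by (auto simp: core_beads_def)
  qed
  then show ?thesis
    using inj_runners by (auto simp: bij_betw_def intro: inj_on_subset)
qed

definition square_class :: "nat \<Rightarrow> int \<times> int \<times> int \<Rightarrow> (int \<times> int \<times> int) set" where
  "square_class n = (\<lambda>(a, b, c). sign_rel (S6 n) `` {(12 * c - 1, 12 * b - 3, 12 * a - 5)})"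

lemma square_triples_iff_S6:
  "(a, b, c) \<in> square_triples n \<longleftrightarrow> (12 * c - 1, 12 * b - 3, 12 * a - 5) \<in> S6 n"
proof -
  have "[12 * c - 1 = - 1] (mod 12)" "[12 * b - 3 = - 3] (mod 12)" "[12 * a - 5 = - 5] (mod 12)"
    by (simp_all add: cong_iff_dvd_diff)
  then show ?thesis
    by (simp only: square_triples_def S6_def mem_Collect_eq prod.case simp_thms)
qed

text \<open>Two normalized coordinates of opposite sign would make 2, 6 or 10 a multiple of 12, so
  distinct triples give distinct classes. Every class is reached by negating the coordinates
  congruent to 1, 3 or 5.\<close>

lemma bij_betw_square_class:
  "bij_betw (square_class n) (square_triples n) (S6 n // sign_rel (S6 n))"
  unfolding bij_betw_def
proof (intro conjI inj_onI equalityI subsetI)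
  fix u v assume uv: "u \<in> square_triples n" "v \<in> square_triples n" "square_class n u = square_class n v"
  obtain a b c a' b' c' where eq: "u = (a, b, c)" "v = (a', b', c')"
    by (metis prod_cases3)
  have "((12 * c - 1, 12 * b - 3, 12 * a - 5), (12 * c' - 1, 12 * b' - 3, 12 * a' - 5)) \<in> sign_rel (S6 n)"
    using uv unfolding eq square_class_def prod.case square_triples_iff_S6
    by (subst (asm) eq_equiv_class_iff[OF equiv_sign_rel])
  then have "12 * c' - 1 = 12 * c - 1 \<or> 12 * c' - 1 = - (12 * c - 1)"
    "12 * b' - 3 = 12 * b - 3 \<or> 12 * b' - 3 = - (12 * b - 3)"
    "12 * a' - 5 = 12 * a - 5 \<or> 12 * a' - 5 = - (12 * a - 5)"
    by (auto simp: sign_rel_def)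
  then have "c' = c" "b' = b" "a' = a"
    by presburger+
  then show "u = v"
    using eq by simp
next
  fix X assume "X \<in> square_class n ` square_triples n"
  then show "X \<in> S6 n // sign_rel (S6 n)"
    by (auto simp: square_class_def square_triples_iff_S6 intro!: quotientI)
next
  fix X assume "X \<in> S6 n // sign_rel (S6 n)"
  then obtain x y z where xyz: "(x, y, z) \<in> S6 n" "X = sign_rel (S6 n) `` {(x, y, z)}"
    by (auto elim: quotientE)
  have "12 dvd x - 1 \<or> 12 dvd x + 1" "12 dvd y - 3 \<or> 12 dvd y + 3" "12 dvd z - 5 \<or> 12 dvd z + 5"
    using xyz(1) by (auto simp: S6_def cong_iff_dvd_diff)
  then have "\<exists>c. x = 12 * c - 1 \<or> x = - (12 * c - 1)" "\<exists>b. y = 12 * b - 3 \<or> y = - (12 * b - 3)"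
    "\<exists>a. z = 12 * a - 5 \<or> z = - (12 * a - 5)"
    by presburger+
  then obtain a b c where abc: "x = 12 * c - 1 \<or> x = - (12 * c - 1)"
    "y = 12 * b - 3 \<or> y = - (12 * b - 3)" "z = 12 * a - 5 \<or> z = - (12 * a - 5)"
    by blast
  then have sq: "x\<^sup>2 = (12 * c - 1)\<^sup>2" "y\<^sup>2 = (12 * b - 3)\<^sup>2" "z\<^sup>2 = (12 * a - 5)\<^sup>2"
    by (metis power2_minus)+
  then have mem: "(a, b, c) \<in> square_triples n"
    using xyz(1) by (simp add: square_triples_def S6_def)
  then have "((x, y, z), (12 * c - 1, 12 * b - 3, 12 * a - 5)) \<in> sign_rel (S6 n)"
    using xyz(1) abc unfolding square_triples_iff_S6 sign_rel_def by auto
  then have "X = square_class n (a, b, c)"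
    unfolding xyz(2) square_class_def prod.case by (intro equiv_class_eq[OF equiv_sign_rel])
  then show "X \<in> square_class n ` square_triples n"
    using mem by blast
qed

theorem theorem3p4:
  fixes n :: nat
  shows "\<exists>f. bij_betw f (SC 6 n) (S6 n // sign_rel (S6 n))"
proof -
  have "bij_betw (\<lambda>lam. range (bead (row lam))) (SC 6 n) (core_beads 6 n)"
    by (rule bij_betw_SC_core_beads) simp
  from bij_betw_trans[OF this
      bij_betw_trans[OF bij_betw_inv_into[OF bij_betw_runners] bij_betw_square_class]]
  show ?thesis
    by blast
qed

end
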